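(* Let $G$ be a totally disconnected locally compact group, and let $\alpha:G\to G$ be a continuous endomorphism. Then $\alpha$ has shadowing.
   Context: All topological spaces are Hausdorff. No compactness, metrizability or invertibility is assumed. Shadowing (with respect to the left uniformity): let $G$ be a topological group with identity $e$ and $\alpha:G\to G$ a continuous endomorphism. For a neighbourhood $V$ of $e$, a sequence $(x_k)_{k\ge 0}$ in $G$ is a $V$-pseudo-orbit for $\alpha$ if $\alpha(x_k)^{-1}x_{k+1}\in V$ for all $k\ge 0$. For a neighbourhood $U$ of $e$, the sequence is $U$-shadowed by $x\in G$ if $\alpha^k(x)^{-1}x_k\in U$ for all $k\ge 0$. The endomorphism $\alpha$ has shadowing if for every neighbourhood $U$ of $e$ there is a neighbourhood $V$ of $e$ such that every one-sided infinite $V$-pseudo-orbit for $\alpha$ is $U$-shadowed by some point of $G$. *)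

theory Defs
  imports "HOL-Analysis.Analysis"
begin

text \<open>
  Topological groups are types of class \<open>topological_group_add\<close>. This class is based on
  \<open>group_add\<close>, so the group need not be commutative although it is written additively:
  the product $xy$ is \<open>x + y\<close>, the inverse of $x$ is \<open>- x\<close>, and the identity is \<open>0\<close>.
  Hence $x^{-1}y$ is \<open>- x + y\<close>, which differs from \<open>y - x\<close> in general. A (not necessarily
  open) neighbourhood of the identity is a set \<open>V\<close> with \<open>0 \<in> interior V\<close>.
\<close>

definition totally_disconnected :: "'a::topological_space set \<Rightarrow> bool"
  where "totally_disconnected S \<longleftrightarrow> (\<forall>x\<in>S. connected_component_set S x = {x})"

definition continuous_endomorphism :: "('a::topological_group_add \<Rightarrow> 'a) \<Rightarrow> bool"
  where "continuous_endomorphism \<alpha> \<longleftrightarrow>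
    (\<forall>x y. \<alpha> (x + y) = \<alpha> x + \<alpha> y) \<and> continuous_on UNIV \<alpha>"

definition pseudo_orbit ::
    "('a::topological_group_add \<Rightarrow> 'a) \<Rightarrow> 'a set \<Rightarrow> (nat \<Rightarrow> 'a) \<Rightarrow> bool"
  where "pseudo_orbit \<alpha> V x \<longleftrightarrow> (\<forall>k. - \<alpha> (x k) + x (Suc k) \<in> V)"

definition shadowed_by ::
    "('a::topological_group_add \<Rightarrow> 'a) \<Rightarrow> 'a set \<Rightarrow> (nat \<Rightarrow> 'a) \<Rightarrow> 'a \<Rightarrow> bool"
  where "shadowed_by \<alpha> U x p \<longleftrightarrow> (\<forall>k. - (\<alpha> ^^ k) p + x k \<in> U)"

definition has_shadowing :: "('a::topological_group_add \<Rightarrow> 'a) \<Rightarrow> bool"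
  where "has_shadowing \<alpha> \<longleftrightarrow>
    (\<forall>U. 0 \<in> interior U \<longrightarrow>
      (\<exists>V. 0 \<in> interior V \<and> (\<forall>x. pseudo_orbit \<alpha> V x \<longrightarrow> (\<exists>p. shadowed_by \<alpha> U x p))))"

end

theory Submission
  imports Defs
begin

text \<open>
  Let \<open>H\<close> be a compact open subgroup inside the given neighbourhood, and let \<open>H\<^sub>n\<close> be the open
  subgroup of all points whose first \<open>n\<close> iterates stay in \<open>H\<close>. The sets of cosets
  \<open>{\<alpha>\<^sup>m\<^sup>+\<^sup>1(x)H | x \<in> H\<^sub>m}\<close> decrease with \<open>m\<close> and are finite, because \<open>\<alpha>(H)\<close> is compact and \<open>H\<close> is
  open. Hence they are constant from some \<open>N\<close> on, and \<open>V = H\<^sub>N\<close> works: if \<open>p\<close> shadows a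
  \<open>V\<close>-pseudo-orbit with errors in \<open>V\<close> up to time \<open>n\<close>, the constancy supplies some \<open>d \<in> H\<^sub>N\<^sub>+\<^sub>n\<close> such
  that \<open>pd\<close> shadows it with errors in \<open>V\<close> up to time \<open>n + 1\<close>. Compactness of \<open>V\<close> then gives a
  point shadowing the whole pseudo-orbit.
\<close>

section \<open>Compact open subgroups\<close>

definition add_subgroup :: "'a::group_add set \<Rightarrow> bool"
  where "add_subgroup H \<longleftrightarrow> 0 \<in> H \<and> (\<forall>x\<in>H. \<forall>y\<in>H. - x + y \<in> H)"

lemma add_subgroup_zero: "add_subgroup H \<Longrightarrow> 0 \<in> H"
  by (simp add: add_subgroup_def)

lemma add_subgroup_diff: "add_subgroup H \<Longrightarrow> x \<in> H \<Longrightarrow> y \<in> H \<Longrightarrow> - x + y \<in> H"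
  by (simp add: add_subgroup_def)

lemma add_subgroup_minus: "add_subgroup H \<Longrightarrow> x \<in> H \<Longrightarrow> - x \<in> H"
  by (metis add_subgroup_diff add_subgroup_zero add.right_neutral)

lemma add_subgroup_add: "add_subgroup H \<Longrightarrow> x \<in> H \<Longrightarrow> y \<in> H \<Longrightarrow> x + y \<in> H"
  by (metis add_subgroup_diff add_subgroup_minus minus_minus)

lemma mem_coset_iff: "y \<in> (+) a ` H \<longleftrightarrow> - a + y \<in> H" for a :: "'a::group_add"
proof
  assume "- a + y \<in> H"
  then have "a + (- a + y) \<in> (+) a ` H" by blast
  then show "y \<in> (+) a ` H" by (simp add: add.assoc[symmetric])
qed auto

lemma coset_eq_iff:
  assumes "add_subgroup H"
  shows "(+) a ` H = (+) b ` H \<longleftrightarrow> - a + b \<in> H"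
proof
  assume "(+) a ` H = (+) b ` H"
  then show "- a + b \<in> H"
    using add_subgroup_zero[OF assms] mem_coset_iff[of b b H] mem_coset_iff[of b a H] by simp
next
  assume ab: "- a + b \<in> H"
  have "- a + y \<in> H \<longleftrightarrow> - b + y \<in> H" for y
  proof
    assume "- a + y \<in> H"
    then have "- (- a + b) + (- a + y) \<in> H"
      by (rule add_subgroup_diff[OF assms ab])
    then show "- b + y \<in> H" by (simp add: minus_add add.assoc)
  next
    assume "- b + y \<in> H"
    then have "(- a + b) + (- b + y) \<in> H"
      by (rule add_subgroup_add[OF assms ab])
    then show "- a + y \<in> H" by (simp add: add.assoc)
  qed
  then show "(+) a ` H = (+) b ` H"
    by (auto simp only: set_eq_iff mem_coset_iff)
qed

lemma coset_vimage: "(+) a ` H = (\<lambda>y. - a + y) -` H" for a :: "'a::group_add"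
  by (auto simp: mem_coset_iff)

lemma open_coset:
  fixes H :: "'a::topological_group_add set"
  assumes "open H"
  shows "open ((+) a ` H)"
  unfolding coset_vimage using assms by (intro open_vimage continuous_intros)

text \<open>The cosets of \<open>H\<close> are open and cover \<open>K\<close>, so finitely many
  suffice. The coset of any point of \<open>K\<close> equals the member of that subcover containing
  the point.\<close>

lemma finite_cosets:
  fixes H :: "'a::topological_group_add set"
  assumes H: "add_subgroup H" "open H" and "compact K"
  shows "finite ((\<lambda>a. (+) a ` H) ` K)"
proof -
  have "K \<subseteq> (\<Union>a\<in>K. (+) a ` H)"
    using add_subgroup_zero[OF H(1)] by (auto simp: mem_coset_iff)
  then obtain F where F: "F \<subseteq> K" "finite F" "K \<subseteq> (\<Union>a\<in>F. (+) a ` H)"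
    using compactE_image[OF \<open>compact K\<close>, of K "\<lambda>a. (+) a ` H"] open_coset[OF H(2)] by metis
  have "(\<lambda>a. (+) a ` H) ` K \<subseteq> (\<lambda>a. (+) a ` H) ` F"
  proof (rule image_subsetI)
    fix b assume "b \<in> K"
    then obtain a where "a \<in> F" "b \<in> (+) a ` H" using F(3) by blast
    then show "(+) b ` H \<in> (\<lambda>a. (+) a ` H) ` F"
      using coset_eq_iff[OF H(1)] mem_coset_iff by blast
  qed
  then show ?thesis by (rule finite_surj[OF F(2)])
qed

text \<open>The complement of \<open>H\<close> is a union of cosets, each of them open.\<close>

lemma open_subgroup_closed:
  fixes H :: "'a::topological_group_add set"
  assumes H: "add_subgroup H" "open H"
  shows "closed H"
proof -
  have self: "a \<in> (+) a ` H" for a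
    using add_subgroup_zero[OF H(1)] by (simp add: mem_coset_iff)
  have disj: "(+) a ` H \<subseteq> - H" if "a \<in> - H" for a
  proof (intro subsetI ComplI)
    fix y assume "y \<in> (+) a ` H" "y \<in> H"
    then have "y + - (- a + y) \<in> H"
      using add_subgroup_add[OF H(1)] add_subgroup_minus[OF H(1)] by (simp only: mem_coset_iff)
    then show False using that by (simp add: minus_add add.assoc[symmetric])
  qed
  have "(\<Union>a\<in>- H. (+) a ` H) = - H"
  proof
    show "(\<Union>a\<in>- H. (+) a ` H) \<subseteq> - H" by (intro UN_least disj)
    show "- H \<subseteq> (\<Union>a\<in>- H. (+) a ` H)" using self by (intro subsetI UN_I)
  qed
  moreover have "open (\<Union>a\<in>- H. (+) a ` H)"
    by (intro open_UN ballI open_coset[OF H(2)])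
  ultimately show ?thesis by (simp add: closed_def)
qed

lemma open_subgroupI:
  fixes H :: "'a::topological_group_add set"
  assumes H: "add_subgroup H" and "open V" "0 \<in> V" "V \<subseteq> H"
  shows "open H"
proof -
  have self: "a \<in> (+) a ` V" for a
    using \<open>0 \<in> V\<close> by (simp add: mem_coset_iff)
  have sub: "(+) a ` V \<subseteq> H" if "a \<in> H" for a
    using add_subgroup_add[OF H that] \<open>V \<subseteq> H\<close> by auto
  have "(\<Union>a\<in>H. (+) a ` V) = H"
  proof
    show "(\<Union>a\<in>H. (+) a ` V) \<subseteq> H" by (intro UN_least sub)
    show "H \<subseteq> (\<Union>a\<in>H. (+) a ` V)" using self by (intro subsetI UN_I)
  qed
  moreover have "open (\<Union>a\<in>H. (+) a ` V)"
    by (intro open_UN ballI open_coset[OF \<open>open V\<close>])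
  ultimately show ?thesis by simp
qed

lemma Hausdorff_space_euclidean_t2: "Hausdorff_space (euclidean :: 'a::t2_space topology)"
  unfolding Hausdorff_space_def disjnt_def using hausdorff by (auto simp flip: open_openin)

lemma compact_open_neighbourhood:
  fixes U :: "'a::t2_space set"
  assumes td: "totally_disconnected (UNIV :: 'a set)"
    and lc: "locally_compact_space (euclidean :: 'a topology)"
    and U: "open U" "x \<in> U"
  obtains K where "compact K" "open K" "x \<in> K" "K \<subseteq> U"
proof -
  obtain W C where WC: "open W" "compact C" "x \<in> W" "W \<subseteq> C"
    using lc unfolding locally_compact_space_def
    by (metis UNIV_I compactin_euclidean_iff open_openin topspace_euclidean)
  \<comment> \<open>The separation theorem below requires a compact Hausdorff space, hence the
    passage to \<open>C\<close>.\<close>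
  let ?X = "top_of_set C"
  have "closed (- (W \<inter> U))" using U(1) WC(1) by (simp only: closed_Compl open_Int)
  then have T: "closedin ?X (C - W \<inter> U)"
    unfolding Diff_eq by (rule closedin_closed_Int)
  \<comment> \<open>A connected set through \<open>x\<close> is just \<open>{x}\<close>, and
    \<open>x\<close> lies in \<open>W \<inter> U\<close>.\<close>
  have dis: "disjnt S {x} \<or> disjnt S (C - W \<inter> U)" if "connectedin ?X S" for S
  proof (cases "x \<in> S")
    case True
    have "connected S" using that by (simp add: connectedin_subtopology)
    then have "S \<subseteq> connected_component_set UNIV x"
      using True by (intro connected_component_maximal) auto
    then show ?thesis
      using td U(2) WC(3) unfolding totally_disconnected_def disjnt_def by auto
  qed (simp add: disjnt_def)
  have "separated_between ?X {x} (C - W \<inter> U)"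
  proof (rule cut_wire_fence_theorem_gen[OF _ _ _ T dis])
    show "compact_space ?X" using WC(2) by (simp add: compact_space_subtopology)
    show "Hausdorff_space ?X \<or> regular_space ?X \<or> normal_space ?X"
      using Hausdorff_space_subtopology[OF Hausdorff_space_euclidean_t2] by blast
    show "compactin ?X {x}" using WC(3,4) by auto
  qed
  then obtain K where K: "closedin ?X K" "openin ?X K" "x \<in> K" "K \<subseteq> W \<inter> U"
    using closedin_subset[of ?X] by (simp add: separated_between disjnt_def) blast
  show thesis
  proof
    show "compact K" using K(1) WC(2) closedin_compact by blast
    obtain S where "open S" "K = C \<inter> S" using K(2) by (auto simp: openin_open)
    \<comment> \<open>\<open>K\<close> is only relatively open in \<open>C\<close>, but it lies in
      \<open>W\<close>, an open subset of \<open>C\<close>; this makes it open in the whole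
      space.\<close>
    then have "K = S \<inter> W" using K(4) WC(4) by blast
    then show "open K" using \<open>open S\<close> WC(1) by blast
  qed (use K in auto)
qed

text \<open>
  The subgroup of van Dantzig's theorem is the stabiliser of a compact open neighbourhood of the
  identity under right translation; compactness makes it open.
\<close>

lemma compact_open_subgroup:
  fixes U :: "'a::{topological_group_add, t2_space} set"
  assumes td: "totally_disconnected (UNIV :: 'a set)"
    and lc: "locally_compact_space (euclidean :: 'a topology)"
    and U: "0 \<in> interior U"
  obtains H where "add_subgroup H" "compact H" "open H" "H \<subseteq> U"
proof -
  obtain K where K: "compact K" "open K" "0 \<in> K" "K \<subseteq> interior U"
    using compact_open_neighbourhood[OF td lc open_interior U] by metis
  \<comment> \<open>Requiring both \<open>k + x\<close> and \<open>k - x\<close> builds closure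
    under inverses into the definition.\<close>
  define H where "H = {x. \<forall>k\<in>K. k + x \<in> K \<and> k - x \<in> K}"
  have sub: "add_subgroup H"
    unfolding add_subgroup_def H_def
  proof (intro conjI ballI CollectI)
    fix x y k
    assume x: "x \<in> {x. \<forall>k\<in>K. k + x \<in> K \<and> k - x \<in> K}"
      and y: "y \<in> {x. \<forall>k\<in>K. k + x \<in> K \<and> k - x \<in> K}" and k: "k \<in> K"
    have "k - x + y \<in> K" using x y k by blast
    then show "k + (- x + y) \<in> K" by (simp add: add.assoc[symmetric])
    have "k - y + x \<in> K" using x y k by blast
    then show "k - (- x + y) \<in> K"
      by (simp only: diff_conv_add_uminus minus_add minus_minus add.assoc)
  qed auto
  have "H \<subseteq> K"
  proof
    fix x assume "x \<in> H"
    then have "0 + x \<in> K" using \<open>0 \<in> K\<close> unfolding H_def by blast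
    then show "x \<in> K" by simp
  qed
  define W where "W = (\<lambda>(k, x). k + x) -` K \<inter> (\<lambda>(k, x). k - x) -` K"
  have "open W" unfolding W_def split_beta
    using \<open>open K\<close> by (intro open_Int open_vimage continuous_intros)
  \<comment> \<open>The tube lemma yields one neighbourhood \<open>V\<close> of \<open>0\<close>
    that works for all points of \<open>K\<close> at once.\<close>
  have "\<exists>A V. openin euclidean A \<and> openin euclidean V \<and> K \<subseteq> A \<and> 0 \<in> V \<and> A \<times> V \<subseteq> W"
  proof (rule tube_lemma_left)
    show "openin (prod_topology euclidean euclidean) W"
      using \<open>open W\<close> by (simp add: euclidean_product_topology)
    show "K \<times> {0} \<subseteq> W" by (auto simp: W_def)
  qed (use K in auto)
  then obtain A V where V: "open V" "K \<subseteq> A" "0 \<in> V" "A \<times> V \<subseteq> W" by auto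
  have "k + x \<in> K \<and> k - x \<in> K" if "k \<in> K" "x \<in> V" for k x
  proof -
    have "(k, x) \<in> W" using V(2,4) that by blast
    then show ?thesis by (simp add: W_def)
  qed
  then have "V \<subseteq> H" unfolding H_def by blast
  then have "open H" using open_subgroupI[OF sub V(1,3)] by blast
  have "compact (K \<inter> H)"
    using K(1) open_subgroup_closed[OF sub \<open>open H\<close>] by (rule compact_Int_closed)
  moreover have "K \<inter> H = H" using \<open>H \<subseteq> K\<close> by blast
  ultimately have "compact H" by simp
  show thesis
    using that[OF sub \<open>compact H\<close> \<open>open H\<close>] \<open>H \<subseteq> K\<close> K(4) interior_subset by blast
qed

section \<open>Points whose iterates stay in a subgroup\<close>

lemma continuous_on_funpow:
  fixes f :: "'a::topological_space \<Rightarrow> 'a"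
  assumes "continuous_on UNIV f"
  shows "continuous_on UNIV (f ^^ n)"
proof (induction n)
  case (Suc n)
  have "continuous_on UNIV (f \<circ> (f ^^ n))"
    by (rule continuous_on_compose[OF Suc continuous_on_subset[OF assms]]) simp
  then show ?case by simp
qed (simp add: id_def)

text \<open>Choose \<open>N\<close> with \<open>card (C N)\<close> minimal: a later set is contained
  in the finite set \<open>C N\<close> and has at least as many elements.\<close>

lemma finite_decseq_stable:
  fixes C :: "nat \<Rightarrow> 'b set"
  assumes "decseq C" and fin: "\<And>n. finite (C n)"
  obtains N where "\<And>n. N \<le> n \<Longrightarrow> C n = C N"
proof -
  obtain N where N: "\<And>n. card (C N) \<le> card (C n)"
    using ex_has_least_nat[of "\<lambda>_. True" 0 "\<lambda>n. card (C n)"] by auto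
  have "C n = C N" if "N \<le> n" for n
    using card_seteq[OF fin decseqD[OF \<open>decseq C\<close> that] N] .
  then show thesis by (rule that)
qed

context
  fixes \<alpha> :: "'a::topological_group_add \<Rightarrow> 'a"
  assumes endo: "continuous_endomorphism \<alpha>"
begin

lemma funpow_add_hom: "(\<alpha> ^^ n) (x + y) = (\<alpha> ^^ n) x + (\<alpha> ^^ n) y"
  using endo by (induction n) (auto simp: continuous_endomorphism_def)

lemma funpow_zero_hom: "(\<alpha> ^^ n) 0 = 0"
  using funpow_add_hom[of n 0 0] by (metis add.right_neutral add_left_cancel)

lemma funpow_minus_hom: "(\<alpha> ^^ n) (- x) = - (\<alpha> ^^ n) x"
  using funpow_add_hom[of n "- x" x] by (simp add: funpow_zero_hom eq_neg_iff_add_eq_0)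

lemma continuous_iterate: "continuous_on S (\<alpha> ^^ n)"
  using endo continuous_on_funpow continuous_on_subset
  unfolding continuous_endomorphism_def by blast

text \<open>The subgroup \<open>H\<^sub>n\<close> of the overview. Time \<open>0\<close> is
  included, so it lies in \<open>H\<close>; being a finite intersection of preimages, it is open
  when \<open>H\<close> is.\<close>

definition stay :: "'a set \<Rightarrow> nat \<Rightarrow> 'a set"
  where "stay H n = (\<Inter>k\<in>{..n}. (\<alpha> ^^ k) -` H)"

lemma stay_iff: "x \<in> stay H n \<longleftrightarrow> (\<forall>k\<le>n. (\<alpha> ^^ k) x \<in> H)"
  by (auto simp: stay_def)

lemma stay_subset: "stay H n \<subseteq> H"
proof
  fix x assume "x \<in> stay H n"
  then have "(\<alpha> ^^ 0) x \<in> H" unfolding stay_iff by blast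
  then show "x \<in> H" by simp
qed

lemma funpow_mem_stay:
  assumes "x \<in> stay H m" "k + n \<le> m"
  shows "(\<alpha> ^^ k) x \<in> stay H n"
  unfolding stay_iff
proof (intro allI impI)
  fix j assume "j \<le> n"
  then have "(\<alpha> ^^ (j + k)) x \<in> H" using assms by (simp add: stay_iff)
  then show "(\<alpha> ^^ j) ((\<alpha> ^^ k) x) \<in> H" by (simp add: funpow_add)
qed

lemma add_subgroup_stay:
  assumes "add_subgroup H"
  shows "add_subgroup (stay H n)"
  using assms unfolding add_subgroup_def[of "stay H n"]
  by (auto simp: stay_iff funpow_zero_hom funpow_add_hom funpow_minus_hom
      add_subgroup_zero add_subgroup_diff)

lemma open_stay: "open H \<Longrightarrow> open (stay H n)"
  unfolding stay_def by (intro open_INT finite_atMost ballI open_vimage continuous_iterate)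

section \<open>Stabilisation of cosets and construction of the shadowing point\<close>

lemma coset_stabilisation:
  assumes H: "add_subgroup H" "open H" "compact H"
  obtains N where "\<And>n y. y \<in> stay H N \<Longrightarrow>
    \<exists>d\<in>stay H (N + n). - (\<alpha> ^^ Suc (N + n)) d + (\<alpha> ^^ Suc N) y \<in> H"
proof -
  define C where "C m = (\<lambda>x. (+) ((\<alpha> ^^ Suc m) x) ` H) ` stay H m" for m
  have "C (Suc m) \<subseteq> C m" for m
  proof
    fix A assume "A \<in> C (Suc m)"
    then obtain x where x: "x \<in> stay H (Suc m)" "A = (+) ((\<alpha> ^^ Suc (Suc m)) x) ` H"
      by (auto simp: C_def)
    \<comment> \<open>One application of \<open>\<alpha>\<close> uses up one step of staying in
      \<open>H\<close>, so \<open>\<alpha> x\<close> represents the same coset in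
      \<open>C m\<close>.\<close>
    have "\<alpha> x \<in> stay H m" using funpow_mem_stay[OF x(1), of 1 m] by simp
    moreover have "A = (+) ((\<alpha> ^^ Suc m) (\<alpha> x)) ` H"
      using x(2) by (simp only: funpow_Suc_right o_apply)
    ultimately show "A \<in> C m" by (auto simp only: C_def)
  qed
  then have "decseq C" by (rule decseq_SucI)
  have "compact (\<alpha> ` H)"
    using H(3) continuous_iterate[of H 1] by (intro compact_continuous_image) simp_all
  have "C m \<subseteq> (\<lambda>a. (+) a ` H) ` \<alpha> ` H" for m
    by (auto simp: C_def stay_iff)
  then have "finite (C m)" for m
    using finite_cosets[OF H(1,2) \<open>compact (\<alpha> ` H)\<close>] finite_subset by blast
  then obtain N where N: "\<And>n. N \<le> n \<Longrightarrow> C n = C N"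
    using finite_decseq_stable[OF \<open>decseq C\<close>] by blast
  have "\<exists>d\<in>stay H (N + n). - (\<alpha> ^^ Suc (N + n)) d + (\<alpha> ^^ Suc N) y \<in> H"
    if "y \<in> stay H N" for n y
  proof -
    have "(+) ((\<alpha> ^^ Suc N) y) ` H \<in> C (N + n)"
      using that N[of "N + n"] by (simp add: C_def)
    then obtain d where "d \<in> stay H (N + n)"
      "(+) ((\<alpha> ^^ Suc N) y) ` H = (+) ((\<alpha> ^^ Suc (N + n)) d) ` H"
      unfolding C_def by (rule imageE)
    then show ?thesis using coset_eq_iff[OF H(1), THEN iffD1, OF sym] by (intro bexI)
  qed
  then show thesis by (rule that)
qed

text \<open>Induction on \<open>n\<close>: a point good up to time \<open>n\<close> is corrected on
  the right by a \<open>d\<close> that preserves the earlier estimates and repairs time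
  \<open>n + 1\<close>.\<close>

lemma finite_shadowing:
  assumes H: "add_subgroup H"
    and N: "\<And>n y. y \<in> stay H N \<Longrightarrow>
      \<exists>d\<in>stay H (N + n). - (\<alpha> ^^ Suc (N + n)) d + (\<alpha> ^^ Suc N) y \<in> H"
    and x: "pseudo_orbit \<alpha> (stay H N) x"
  shows "\<exists>p. \<forall>k\<le>n. - (\<alpha> ^^ k) p + x k \<in> stay H N"
proof (induction n)
  case 0
  show ?case
    using add_subgroup_zero[OF add_subgroup_stay[OF H]] by (intro exI[of _ "x 0"]) simp
next
  case (Suc n)
  let ?W = "stay H N"
  have W: "add_subgroup ?W" by (rule add_subgroup_stay[OF H])
  obtain p where p: "\<And>k. k \<le> n \<Longrightarrow> - (\<alpha> ^^ k) p + x k \<in> ?W"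
    using Suc by blast
  define y where "y = - (\<alpha> ^^ n) p + x n"
  have "y \<in> ?W" using p by (simp add: y_def)
  then obtain d where d: "d \<in> stay H (N + n)" "- (\<alpha> ^^ Suc (N + n)) d + (\<alpha> ^^ Suc N) y \<in> H"
    using N by blast
  have shift: "- (\<alpha> ^^ k) (p + d) + z = - (\<alpha> ^^ k) d + (- (\<alpha> ^^ k) p + z)" for k z
    by (simp only: funpow_add_hom minus_add add.assoc)
  \<comment> \<open>As \<open>d\<close> stays in \<open>H\<close> up to time \<open>N + n\<close>,
    its iterates up to time \<open>n\<close> lie in the subgroup \<open>?W\<close>, so the old
    errors remain in \<open>?W\<close>.\<close>
  have le: "- (\<alpha> ^^ k) (p + d) + x k \<in> ?W" if "k \<le> n" for k
    unfolding shift using that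
    by (intro add_subgroup_diff[OF W] p funpow_mem_stay[OF d(1)]) auto
  define z where "z = - (\<alpha> ^^ n) (p + d) + x n"
  have z: "z \<in> ?W" using le by (simp add: z_def)
  have zy: "z = - (\<alpha> ^^ n) d + y" by (simp add: z_def y_def shift)
  define v where "v = - \<alpha> (x n) + x (Suc n)"
  have v: "v \<in> ?W" using x by (simp add: v_def pseudo_orbit_def)
  have "- (\<alpha> ^^ Suc n) (p + d) + x (Suc n) = \<alpha> z + v"
    using funpow_add_hom[of 1] funpow_minus_hom[of 1]
    by (simp add: z_def v_def add.assoc)
  moreover have "\<alpha> z + v \<in> ?W"
    unfolding stay_iff
  proof (intro allI impI)
    fix j assume j: "j \<le> N"
    have "(\<alpha> ^^ Suc j) z \<in> H"
    \<comment> \<open>Membership of \<open>z\<close> in \<open>?W\<close> controls its iterates only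
      up to time \<open>N\<close>. The iterate at time \<open>N + 1\<close> is exactly what
      \<open>d\<close> was chosen for.\<close>
    proof (cases "j = N")
      case True
      have "(\<alpha> ^^ Suc N) z = - (\<alpha> ^^ (Suc N + n)) d + (\<alpha> ^^ Suc N) y"
        unfolding zy funpow_add_hom funpow_minus_hom funpow_add o_apply ..
      then show ?thesis using d(2) True by simp
    next
      case False
      then show ?thesis using z j unfolding stay_iff by (meson Suc_leI le_neq_implies_less)
    qed
    moreover have "(\<alpha> ^^ j) (\<alpha> z + v) = (\<alpha> ^^ Suc j) z + (\<alpha> ^^ j) v"
      by (simp only: funpow_add_hom funpow_Suc_right o_apply)
    ultimately show "(\<alpha> ^^ j) (\<alpha> z + v) \<in> H"
      using v j add_subgroup_add[OF H] by (simp only: stay_iff)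
  qed
  ultimately show ?case
    using le by (intro exI[of _ "p + d"]) (auto simp: le_Suc_eq)
qed

text \<open>The points whose error at time \<open>k\<close> lies in \<open>W\<close> form a closed
  set \<open>F k\<close>. Finitely many of these sets always meet, and \<open>F 0\<close> is
  compact, so all of them share a point.\<close>

lemma shadowing_from_finite:
  assumes W: "compact W" "closed W"
    and fin: "\<And>n. \<exists>p. \<forall>k\<le>n. - (\<alpha> ^^ k) p + x k \<in> W"
  shows "\<exists>p. shadowed_by \<alpha> W x p"
proof -
  define F where "F k = (\<lambda>p. - (\<alpha> ^^ k) p + x k) -` W" for k
  have cl: "closed (F k)" for k
    unfolding F_def using W(2) by (intro closed_vimage continuous_intros continuous_iterate)
  \<comment> \<open>Solving \<open>- p + x 0 = w\<close> for \<open>p\<close> shows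
    \<open>F 0\<close> as a continuous image of the compact set \<open>W\<close>.\<close>
  have "F 0 = (\<lambda>w. x 0 - w) ` W"
  proof
    show "F 0 \<subseteq> (\<lambda>w. x 0 - w) ` W"
    proof
      fix p assume "p \<in> F 0"
      then have "- p + x 0 \<in> W" by (simp add: F_def)
      moreover have "p = x 0 - (- p + x 0)"
        by (simp only: diff_conv_add_uminus minus_add minus_minus) (simp add: add.assoc[symmetric])
      ultimately show "p \<in> (\<lambda>w. x 0 - w) ` W" by blast
    qed
    show "(\<lambda>w. x 0 - w) ` W \<subseteq> F 0"
      by (auto simp: F_def add.assoc[symmetric])
  qed
  then have "compact (F 0)"
    using W(1) by (simp only:) (intro compact_continuous_image continuous_intros)
  then have "F 0 \<inter> (\<Inter>k\<in>UNIV. F k) \<noteq> {}"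
  proof (rule compact_imp_fip_image[OF _ cl])
    fix I :: "nat set" assume "finite I"
    then obtain n where "I \<subseteq> {..n}" by (metis finite_nat_iff_bounded_le)
    moreover obtain p where "\<And>k. k \<le> n \<Longrightarrow> - (\<alpha> ^^ k) p + x k \<in> W" using fin by blast
    then have "p \<in> F k" if "k \<le> n" for k using that by (simp only: F_def vimage_eq)
    ultimately have "p \<in> F 0 \<inter> (\<Inter>k\<in>I. F k)" by blast
    then show "F 0 \<inter> (\<Inter>k\<in>I. F k) \<noteq> {}" by blast
  qed
  then show ?thesis by (auto simp: shadowed_by_def F_def)
qed

end

theorem theorem3:
  fixes \<alpha> :: "'a::{topological_group_add, t2_space} \<Rightarrow> 'a"
  assumes "totally_disconnected (UNIV :: 'a set)"
    and "locally_compact_space (euclidean :: 'a topology)"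
    and "continuous_endomorphism \<alpha>"
  shows "has_shadowing \<alpha>"
  unfolding has_shadowing_def
proof (intro allI impI)
  fix U :: "'a set" assume "0 \<in> interior U"
  then obtain H where H: "add_subgroup H" "compact H" "open H" "H \<subseteq> U"
    using compact_open_subgroup[OF assms(1,2)] by blast
  obtain N where N: "\<And>n y. y \<in> stay \<alpha> H N \<Longrightarrow>
    \<exists>d\<in>stay \<alpha> H (N + n). - (\<alpha> ^^ Suc (N + n)) d + (\<alpha> ^^ Suc N) y \<in> H"
    using coset_stabilisation[OF assms(3) H(1,3,2)] by blast
  define V where "V = stay \<alpha> H N"
  have V: "add_subgroup V" "open V" "V \<subseteq> H"
    using add_subgroup_stay[OF assms(3) H(1)] open_stay[OF assms(3) H(3)]
      stay_subset[OF assms(3)] by (simp_all add: V_def)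
  \<comment> \<open>An open subgroup is closed, and \<open>V\<close> lies in the compact set
    \<open>H\<close>; both facts feed the limit argument.\<close>
  have "closed V" using V open_subgroup_closed by blast
  then have "compact V"
    using compact_Int_closed[OF H(2)] V(3) by (metis inf.absorb2)
  have "\<exists>p. shadowed_by \<alpha> U x p" if "pseudo_orbit \<alpha> V x" for x
  proof -
    have "\<exists>p. \<forall>k\<le>n. - (\<alpha> ^^ k) p + x k \<in> V" for n
      using finite_shadowing[OF assms(3) H(1) N] that by (simp add: V_def)
    then obtain p where "shadowed_by \<alpha> V x p"
      using shadowing_from_finite[OF assms(3) \<open>compact V\<close> \<open>closed V\<close>] by blast
    then show ?thesis using V(3) H(4) unfolding shadowed_by_def by blast
  qed
  moreover have "0 \<in> interior V"
    using V add_subgroup_zero by (simp add: interior_open)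
  ultimately show "\<exists>V. 0 \<in> interior V \<and> (\<forall>x. pseudo_orbit \<alpha> V x \<longrightarrow> (\<exists>p. shadowed_by \<alpha> U x p))"
    by blast
qed

end
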